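(* Let $(\mathfrak g,B,S)$ be a quadratic Rota-Baxter Lie algebra of weight $-1$, let $\widetilde B=\mathrm{id}-B$, and let $((\mathfrak g_+\bowtie\mathfrak g_-,S'),\mathfrak g_+,\mathfrak g_-)$ be the Manin triple on $(\mathfrak g,B,S)$. Then the operators $C,\widetilde C:\mathfrak g_+\bowtie\mathfrak g_-\to\mathfrak g_+\bowtie\mathfrak g_-$ given, for all $x_1,x_2\in\mathfrak g$, by $$C\big((B(x_1),\widetilde B(x_2))\big)=\big(B(B(x_1)+\widetilde B(x_2)),\ \widetilde B(B(x_1)+\widetilde B(x_2))\big),$$ $$\widetilde C\big((B(x_1),\widetilde B(x_2))\big)=\big(B\circ\widetilde B(x_1-x_2),\ -\widetilde B\circ B(x_1-x_2)\big)$$ are quadratic Lie algebra projections on the Manin triple $((\mathfrak g_+\bowtie\mathfrak g_-,S'),\mathfrak g_+,\mathfrak g_-)$ such that $C+\widetilde C=\mathrm{id}_{\mathfrak g_+\bowtie\mathfrak g_-}$.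
   Context: Lie algebras are over a field $\mathbb K$. A Rota-Baxter operator of weight $\lambda$ on a Lie algebra $\mathfrak g$ is a linear map $B:\mathfrak g\to\mathfrak g$ with $[B(x),B(y)]=B([B(x),y]+[x,B(y)]+\lambda[x,y])$. A quadratic Lie algebra $(\mathfrak g,S)$ is a Lie algebra with a nondegenerate symmetric bilinear form $S:\mathfrak g\times\mathfrak g\to\mathbb K$ satisfying $S([x,y],z)=S(x,[y,z])$. A quadratic Rota-Baxter Lie algebra of weight $\lambda$ is a triple $(\mathfrak g,B,S)$ with $B$ a Rota-Baxter operator of weight $\lambda$ on $\mathfrak g$, $(\mathfrak g,S)$ a quadratic Lie algebra, and $S(B(x),y)+S(x,B(y))+\lambda S(x,y)=0$ for all $x,y$. A Manin triple $((\mathfrak d,S),\mathfrak d_+,\mathfrak d_-)$ consists of a quadratic Lie algebra $(\mathfrak d,S)$ and isotropic Lie subalgebras $\mathfrak d_\pm$ with $\mathfrak d=\mathfrak d_+\oplus\mathfrak d_-$ as vector spaces. A quadratic Lie algebra projection on it is an idempotent Lie algebra homomorphism $C:\mathfrak d\to\mathfrak d$ such that, with $\widetilde C=\mathrm{id}_{\mathfrak d}-C$, one has $S(C(z),\widetilde C(w))=0$ for all $z,w\in\mathfrak d$. For $(\mathfrak g,B)$ of weight $-1$ put $\widetilde B=\mathrm{id}-B$, $\mathfrak g_+=\mathrm{Im}\,B$, $\mathfrak g_-=\mathrm{Im}\,\widetilde B$, with the well-defined maps $B(x)\rhd\widetilde B(y)=\widetilde B([B(x),y])$ and $\widetilde B(x)\blacktriangleright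 B(y)=B([\widetilde B(x),y])$. The Lie algebra $\mathfrak g_+\bowtie\mathfrak g_-$ is the (external) vector space direct sum $\mathfrak g_+\oplus\mathfrak g_-$ with bracket $$[(x,u),(y,v)]_{\bowtie}=\big([x,y]+u\blacktriangleright y-v\blacktriangleright x,\ [u,v]+x\rhd v-y\rhd u\big).$$ The Manin triple on $(\mathfrak g,B,S)$ is $((\mathfrak g_+\bowtie\mathfrak g_-,S'),\mathfrak g_+,\mathfrak g_-)$, where $S'\big((B(x_1),\widetilde B(x_2)),(B(y_1),\widetilde B(y_2))\big)=S(B(x_1),y_2)+S(B(y_1),x_2)$ for $x_1,x_2,y_1,y_2\in\mathfrak g$. *)

theory Defs
  imports "HOL-Analysis.Product_Vector"
begin

text \<open>
  All structures live on explicit carriers, which are subspaces of an ambient vector space over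
  an arbitrary field: the carrier of the double of a Rota-Baxter Lie algebra is a proper subset
  of a product type in general. No finiteness of dimension and no restriction on the
  characteristic is imposed. Maps and brackets are unconstrained outside the carriers.
\<close>

definition linear_map_on ::
  "('k::field \<Rightarrow> 'v::ab_group_add \<Rightarrow> 'v) \<Rightarrow> ('k \<Rightarrow> 'w::ab_group_add \<Rightarrow> 'w) \<Rightarrow> 'v set \<Rightarrow> ('v \<Rightarrow> 'w) \<Rightarrow> bool"
  where "linear_map_on s1 s2 V f \<longleftrightarrow>
    (\<forall>x\<in>V. \<forall>y\<in>V. f (x + y) = f x + f y) \<and> (\<forall>a. \<forall>x\<in>V. f (s1 a x) = s2 a (f x))"

definition bilinear_map_on ::
  "('k::field \<Rightarrow> 'v::ab_group_add \<Rightarrow> 'v) \<Rightarrow> ('k \<Rightarrow> 'w::ab_group_add \<Rightarrow> 'w) \<Rightarrow> 'v set \<Rightarrow> ('v \<Rightarrow> 'v \<Rightarrow> 'w) \<Rightarrow> bool"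
  where "bilinear_map_on s1 s2 V f \<longleftrightarrow>
    (\<forall>x\<in>V. linear_map_on s1 s2 V (\<lambda>y. f x y)) \<and> (\<forall>y\<in>V. linear_map_on s1 s2 V (\<lambda>x. f x y))"


subsection \<open>Quadratic Lie algebras\<close>

locale lie_algebra = vector_space scale
  for scale :: "'k::field \<Rightarrow> 'v::ab_group_add \<Rightarrow> 'v" +
  fixes L :: "'v set"
    and br :: "'v \<Rightarrow> 'v \<Rightarrow> 'v"
  assumes subspace_carrier: "subspace L"
    and bracket_closed: "\<lbrakk>x \<in> L; y \<in> L\<rbrakk> \<Longrightarrow> br x y \<in> L"
    and bracket_bilinear: "bilinear_map_on scale scale L br"
    and bracket_alternating: "x \<in> L \<Longrightarrow> br x x = 0"
    and jacobi: "\<lbrakk>x \<in> L; y \<in> L; z \<in> L\<rbrakk> \<Longrightarrow>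
      br x (br y z) + br y (br z x) + br z (br x y) = 0"
begin

definition lie_subalgebra :: "'v set \<Rightarrow> bool"
  where "lie_subalgebra M \<longleftrightarrow> subspace M \<and> M \<subseteq> L \<and> (\<forall>x\<in>M. \<forall>y\<in>M. br x y \<in> M)"

definition lie_endomorphism :: "('v \<Rightarrow> 'v) \<Rightarrow> bool"
  where "lie_endomorphism f \<longleftrightarrow>
    f ` L \<subseteq> L \<and> linear_map_on scale scale L f \<and> (\<forall>x\<in>L. \<forall>y\<in>L. f (br x y) = br (f x) (f y))"

end

locale quadratic_lie_algebra = lie_algebra scale L br
  for scale :: "'k::field \<Rightarrow> 'v::ab_group_add \<Rightarrow> 'v"
    and L :: "'v set"
    and br :: "'v \<Rightarrow> 'v \<Rightarrow> 'v" +
  fixes S :: "'v \<Rightarrow> 'v \<Rightarrow> 'k"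
  assumes form_bilinear: "bilinear_map_on scale (*) L S"
    and form_symmetric: "\<lbrakk>x \<in> L; y \<in> L\<rbrakk> \<Longrightarrow> S x y = S y x"
    and form_nondegenerate: "\<lbrakk>x \<in> L; \<And>y. y \<in> L \<Longrightarrow> S x y = 0\<rbrakk> \<Longrightarrow> x = 0"
    and form_invariant: "\<lbrakk>x \<in> L; y \<in> L; z \<in> L\<rbrakk> \<Longrightarrow> S (br x y) z = S x (br y z)"
begin

definition isotropic :: "'v set \<Rightarrow> bool"
  where "isotropic M \<longleftrightarrow> (\<forall>x\<in>M. \<forall>y\<in>M. S x y = 0)"

end


subsection \<open>Rota-Baxter operators\<close>

locale rota_baxter_lie_algebra = lie_algebra scale L br
  for scale :: "'k::field \<Rightarrow> 'v::ab_group_add \<Rightarrow> 'v"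
    and L :: "'v set"
    and br :: "'v \<Rightarrow> 'v \<Rightarrow> 'v" +
  fixes B :: "'v \<Rightarrow> 'v"
    and wt :: 'k
  assumes operator_closed: "x \<in> L \<Longrightarrow> B x \<in> L"
    and operator_linear: "linear_map_on scale scale L B"
    and rota_baxter: "\<lbrakk>x \<in> L; y \<in> L\<rbrakk> \<Longrightarrow>
      br (B x) (B y) = B (br (B x) y + br x (B y) + scale wt (br x y))"

locale quadratic_rota_baxter_lie_algebra =
  rota_baxter_lie_algebra scale L br B wt + quadratic_lie_algebra scale L br S
  for scale :: "'k::field \<Rightarrow> 'v::ab_group_add \<Rightarrow> 'v"
    and L :: "'v set"
    and br :: "'v \<Rightarrow> 'v \<Rightarrow> 'v"
    and B :: "'v \<Rightarrow> 'v"
    and S :: "'v \<Rightarrow> 'v \<Rightarrow> 'k"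
    and wt :: 'k +
  assumes form_compatible: "\<lbrakk>x \<in> L; y \<in> L\<rbrakk> \<Longrightarrow> S (B x) y + S x (B y) + wt * S x y = 0"


subsection \<open>Manin triples and their projections\<close>

locale manin_triple = quadratic_lie_algebra scale D br S
  for scale :: "'k::field \<Rightarrow> 'v::ab_group_add \<Rightarrow> 'v"
    and D :: "'v set"
    and br :: "'v \<Rightarrow> 'v \<Rightarrow> 'v"
    and S :: "'v \<Rightarrow> 'v \<Rightarrow> 'k" +
  fixes Dp Dm :: "'v set"
  assumes subalgebra_plus: "lie_subalgebra Dp"
    and subalgebra_minus: "lie_subalgebra Dm"
    and isotropic_plus: "isotropic Dp"
    and isotropic_minus: "isotropic Dm"
    and sum_eq: "D = {x + y | x y. x \<in> Dp \<and> y \<in> Dm}"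
    and direct: "Dp \<inter> Dm = {0}"

locale quadratic_lie_algebra_projection = manin_triple scale D br S Dp Dm
  for scale :: "'k::field \<Rightarrow> 'v::ab_group_add \<Rightarrow> 'v"
    and D :: "'v set"
    and br :: "'v \<Rightarrow> 'v \<Rightarrow> 'v"
    and S :: "'v \<Rightarrow> 'v \<Rightarrow> 'k"
    and Dp Dm :: "'v set" +
  fixes C :: "'v \<Rightarrow> 'v"
  assumes endomorphism: "lie_endomorphism C"
    and idempotent: "z \<in> D \<Longrightarrow> C (C z) = C z"
    and orthogonal: "\<lbrakk>z \<in> D; w \<in> D\<rbrakk> \<Longrightarrow> S (C z) (w - C w) = 0"


subsection \<open>The Manin triple on a quadratic Rota-Baxter Lie algebra of weight $-1$\<close>

definition rb_tilde :: "('v::ab_group_add \<Rightarrow> 'v) \<Rightarrow> 'v \<Rightarrow> 'v"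
  where "rb_tilde B x = x - B x"

text \<open>
  Maps prescribed on representatives are given by definite description, so that no choice of
  representatives enters; \<open>rb_act_plus_eq\<close>, \<open>rb_act_minus_eq\<close> and \<open>rb_double_form_eq\<close> below
  show that the descriptions are well defined.
\<close>

definition rb_act_plus ::
  "'v::ab_group_add set \<Rightarrow> ('v \<Rightarrow> 'v \<Rightarrow> 'v) \<Rightarrow> ('v \<Rightarrow> 'v) \<Rightarrow> 'v \<Rightarrow> 'v \<Rightarrow> 'v"
  where "rb_act_plus L br B a v = (THE w. \<exists>x\<in>L. \<exists>y\<in>L.
    a = B x \<and> v = rb_tilde B y \<and> w = rb_tilde B (br (B x) y))"

definition rb_act_minus ::
  "'v::ab_group_add set \<Rightarrow> ('v \<Rightarrow> 'v \<Rightarrow> 'v) \<Rightarrow> ('v \<Rightarrow> 'v) \<Rightarrow> 'v \<Rightarrow> 'v \<Rightarrow> 'v"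
  where "rb_act_minus L br B u b = (THE w. \<exists>x\<in>L. \<exists>y\<in>L.
    u = rb_tilde B x \<and> b = B y \<and> w = B (br (rb_tilde B x) y))"

definition rb_double :: "'v::ab_group_add set \<Rightarrow> ('v \<Rightarrow> 'v) \<Rightarrow> ('v \<times> 'v) set"
  where "rb_double L B = (B ` L) \<times> (rb_tilde B ` L)"

definition rb_double_plus :: "'v::ab_group_add set \<Rightarrow> ('v \<Rightarrow> 'v) \<Rightarrow> ('v \<times> 'v) set"
  where "rb_double_plus L B = (B ` L) \<times> {0}"

definition rb_double_minus :: "'v::ab_group_add set \<Rightarrow> ('v \<Rightarrow> 'v) \<Rightarrow> ('v \<times> 'v) set"
  where "rb_double_minus L B = {0} \<times> (rb_tilde B ` L)"

fun rb_double_bracket ::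
  "'v::ab_group_add set \<Rightarrow> ('v \<Rightarrow> 'v \<Rightarrow> 'v) \<Rightarrow> ('v \<Rightarrow> 'v) \<Rightarrow> 'v \<times> 'v \<Rightarrow> 'v \<times> 'v \<Rightarrow> 'v \<times> 'v"
  where "rb_double_bracket L br B (x, u) (y, v) =
    (br x y + rb_act_minus L br B u y - rb_act_minus L br B v x,
     br u v + rb_act_plus L br B x v - rb_act_plus L br B y u)"

definition rb_double_form ::
  "'v::ab_group_add set \<Rightarrow> ('v \<Rightarrow> 'v) \<Rightarrow> ('v \<Rightarrow> 'v \<Rightarrow> 'k::field) \<Rightarrow> 'v \<times> 'v \<Rightarrow> 'v \<times> 'v \<Rightarrow> 'k"
  where "rb_double_form L B S z w = (THE c. \<exists>x1\<in>L. \<exists>x2\<in>L. \<exists>y1\<in>L. \<exists>y2\<in>L.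
    z = (B x1, rb_tilde B x2) \<and> w = (B y1, rb_tilde B y2) \<and>
    c = S (B x1) y2 + S (B y1) x2)"

definition rb_proj :: "'v::ab_group_add set \<Rightarrow> ('v \<Rightarrow> 'v) \<Rightarrow> 'v \<times> 'v \<Rightarrow> 'v \<times> 'v"
  where "rb_proj L B z = (THE w. \<exists>x1\<in>L. \<exists>x2\<in>L. z = (B x1, rb_tilde B x2) \<and>
    w = (B (B x1 + rb_tilde B x2), rb_tilde B (B x1 + rb_tilde B x2)))"

definition rb_proj_tilde :: "'v::ab_group_add set \<Rightarrow> ('v \<Rightarrow> 'v) \<Rightarrow> 'v \<times> 'v \<Rightarrow> 'v \<times> 'v"
  where "rb_proj_tilde L B z = (THE w. \<exists>x1\<in>L. \<exists>x2\<in>L. z = (B x1, rb_tilde B x2) \<and>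
    w = (B (rb_tilde B (x1 - x2)), - rb_tilde B (B (x1 - x2))))"


subsection \<open>Well-definedness\<close>

context lie_algebra
begin

lemma carrier_diff: "\<lbrakk>x \<in> L; y \<in> L\<rbrakk> \<Longrightarrow> x - y \<in> L"
  using subspace_carrier by (rule subspace_diff)

lemma bracket_diff_right:
  assumes "x \<in> L" "y \<in> L" "z \<in> L"
  shows "br x (y - z) = br x y - br x z"
proof -
  have "br x ((y - z) + z) = br x (y - z) + br x z"
    using bracket_bilinear assms carrier_diff
    unfolding bilinear_map_on_def linear_map_on_def by blast
  then show ?thesis by (simp add: algebra_simps)
qed

end

context rota_baxter_lie_algebra
begin

lemma operator_diff:
  assumes "x \<in> L" "y \<in> L"
  shows "B (x - y) = B x - B y"
proof -
  have "B ((x - y) + y) = B (x - y) + B y"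
    using operator_linear assms carrier_diff unfolding linear_map_on_def by blast
  then show ?thesis by (simp add: algebra_simps)
qed

lemma tilde_diff: "\<lbrakk>x \<in> L; y \<in> L\<rbrakk> \<Longrightarrow> rb_tilde B (x - y) = rb_tilde B x - rb_tilde B y"
  by (simp add: rb_tilde_def operator_diff)

lemma tilde_closed: "x \<in> L \<Longrightarrow> rb_tilde B x \<in> L"
  by (simp add: rb_tilde_def operator_closed carrier_diff)

lemma tilde_bracket_ker:
  assumes wt: "wt = -1" and L: "x \<in> L" "k \<in> L" and k: "rb_tilde B k = 0"
  shows "rb_tilde B (br (B x) k) = 0"
proof -
  have Bk: "B k = k" using k by (simp add: rb_tilde_def)
  have "br (B x) k = B (br (B x) k + br x k + scale (-1) (br x k))"
    using rota_baxter[OF L] Bk wt by simp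
  then show ?thesis by (simp add: rb_tilde_def scale_minus_left)
qed

lemma bracket_tilde_ker:
  assumes wt: "wt = -1" and L: "x \<in> L" "k \<in> L" and k: "B k = 0"
  shows "B (br (rb_tilde B x) k) = 0"
proof -
  have z: "br w 0 = 0" if "w \<in> L" for w
    using bracket_diff_right[of w 0 0] subspace_0[OF subspace_carrier] that by simp
  have c: "br (B x) k \<in> L" "br x k \<in> L"
    using L operator_closed bracket_closed by auto
  have "0 = B (br (B x) k + br x 0 + scale (-1) (br x k))"
    using rota_baxter[OF L] k wt z operator_closed L by simp
  then have e: "B (br (B x) k - br x k) = 0"
    using z L by (simp add: scale_minus_left)
  have lin: "linear_map_on scale scale L (\<lambda>y. br y k)"
    using bracket_bilinear L unfolding bilinear_map_on_def by blast
  have "br ((x - B x) + B x) k = br (x - B x) k + br (B x) k"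
    using lin L operator_closed carrier_diff unfolding linear_map_on_def by blast
  then have "br (rb_tilde B x) k = br x k - br (B x) k"
    by (simp add: rb_tilde_def algebra_simps)
  then show ?thesis using e c operator_diff by auto
qed

lemma rb_act_plus_eq:
  assumes wt: "wt = -1" and L: "x \<in> L" "y \<in> L"
  shows "rb_act_plus L br B (B x) (rb_tilde B y) = rb_tilde B (br (B x) y)"
  unfolding rb_act_plus_def
proof (rule the_equality)
  show "\<exists>x'\<in>L. \<exists>y'\<in>L. B x = B x' \<and> rb_tilde B y = rb_tilde B y' \<and>
      rb_tilde B (br (B x) y) = rb_tilde B (br (B x') y')" using L by blast
next
  fix w assume "\<exists>x'\<in>L. \<exists>y'\<in>L. B x = B x' \<and> rb_tilde B y = rb_tilde B y' \<and>
      w = rb_tilde B (br (B x') y')"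
  then obtain y' where y': "y' \<in> L" "rb_tilde B y = rb_tilde B y'" "w = rb_tilde B (br (B x) y')"
    by auto
  have "rb_tilde B (br (B x) (y - y')) = 0"
    using tilde_bracket_ker[OF wt, of x "y - y'"] L y' by (simp add: carrier_diff tilde_diff)
  then show "w = rb_tilde B (br (B x) y)"
    using L y' by (simp add: bracket_diff_right operator_closed tilde_diff bracket_closed)
qed

lemma rb_act_minus_eq:
  assumes wt: "wt = -1" and L: "x \<in> L" "y \<in> L"
  shows "rb_act_minus L br B (rb_tilde B x) (B y) = B (br (rb_tilde B x) y)"
  unfolding rb_act_minus_def
proof (rule the_equality)
  show "\<exists>x'\<in>L. \<exists>y'\<in>L. rb_tilde B x = rb_tilde B x' \<and> B y = B y' \<and>
      B (br (rb_tilde B x) y) = B (br (rb_tilde B x') y')" using L by blast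
next
  fix w assume "\<exists>x'\<in>L. \<exists>y'\<in>L. rb_tilde B x = rb_tilde B x' \<and> B y = B y' \<and>
      w = B (br (rb_tilde B x') y')"
  then obtain y' where y': "y' \<in> L" "B y = B y'" "w = B (br (rb_tilde B x) y')"
    by auto
  have "B (br (rb_tilde B x) (y - y')) = 0"
    using bracket_tilde_ker[OF wt, of x "y - y'"] L y' by (simp add: carrier_diff operator_diff)
  then show "w = B (br (rb_tilde B x) y)"
    using L y' by (simp add: bracket_diff_right tilde_closed operator_diff bracket_closed)
qed

end

context quadratic_rota_baxter_lie_algebra
begin

lemma form_operator_ker:
  assumes wt: "wt = -1" and L: "x \<in> L" "y \<in> L" "y' \<in> L" and y: "rb_tilde B y = rb_tilde B y'"
  shows "S (B x) y = S (B x) y'"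
proof -
  have d: "y - y' \<in> L" using L by (simp add: carrier_diff)
  have "rb_tilde B (y - y') = 0"
    using tilde_diff[of y y'] y L by simp
  then have "B (y - y') = y - y'" by (simp add: rb_tilde_def)
  then have z: "S (B x) (y - y') = 0"
    using form_compatible[OF L(1) d] wt by simp
  have "linear_map_on scale (*) L (S (B x))"
    using form_bilinear operator_closed L unfolding bilinear_map_on_def by blast
  then have "S (B x) ((y - y') + y') = S (B x) (y - y') + S (B x) y'"
    using d L unfolding linear_map_on_def by blast
  with z show ?thesis by simp
qed

lemma rb_double_form_eq:
  assumes wt: "wt = -1" and L: "x1 \<in> L" "x2 \<in> L" "y1 \<in> L" "y2 \<in> L"
  shows "rb_double_form L B S (B x1, rb_tilde B x2) (B y1, rb_tilde B y2)
    = S (B x1) y2 + S (B y1) x2"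
  unfolding rb_double_form_def
proof (rule the_equality)
  show "\<exists>x1'\<in>L. \<exists>x2'\<in>L. \<exists>y1'\<in>L. \<exists>y2'\<in>L.
      (B x1, rb_tilde B x2) = (B x1', rb_tilde B x2') \<and>
      (B y1, rb_tilde B y2) = (B y1', rb_tilde B y2') \<and>
      S (B x1) y2 + S (B y1) x2 = S (B x1') y2' + S (B y1') x2'"
    using L by blast
next
  fix c assume "\<exists>x1'\<in>L. \<exists>x2'\<in>L. \<exists>y1'\<in>L. \<exists>y2'\<in>L.
      (B x1, rb_tilde B x2) = (B x1', rb_tilde B x2') \<and>
      (B y1, rb_tilde B y2) = (B y1', rb_tilde B y2') \<and>
      c = S (B x1') y2' + S (B y1') x2'"
  then obtain x2' y2' where "x2' \<in> L" "y2' \<in> L" "rb_tilde B x2 = rb_tilde B x2'"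
    "rb_tilde B y2 = rb_tilde B y2'" "c = S (B x1) y2' + S (B y1) x2'" by auto
  then show "c = S (B x1) y2 + S (B y1) x2"
    using form_operator_ker[OF wt] L by metis
qed

end

end

theory Submission
  imports Defs
begin

text \<open>
  Write \<open>T = id - B\<close>. The double \<open>g\<^sub>+ \<bowtie> g\<^sub>-\<close> is, as a quadratic Lie algebra, an orthogonal
  direct sum of two ideals that commute with each other, and the two operators of the theorem
  are the projections onto these ideals. Once this is seen, everything is read off componentwise.

  The first ideal is the image of \<open>p \<mapsto> (B p, T p)\<close>, a Lie algebra homomorphism, and an injective one
  because \<open>B p + T p = p\<close>. The second is the image of \<open>q \<mapsto> (B (T q), - T (B q))\<close>, which is the kernel of
  the addition map \<open>(a, u) \<mapsto> a + u\<close>. On it the bracket comes from the descendent bracket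
  \<open>[x, y]\<^sub>B = [B x, y] + [x, B y] - [x, y]\<close>, which is again a Lie bracket on the original space
  and for which \<open>B\<close> and \<open>- T\<close> are homomorphisms to the original bracket. Together the two maps
  give a linear surjection from pairs \<open>(p, q)\<close> onto the double, the function \<open>double_split\<close>
  below, and three formulas carry the proof:

  \<^item> a pair \<open>(B x\<^sub>1, T x\<^sub>2)\<close> comes from \<open>p = B x\<^sub>1 + T x\<^sub>2\<close> and \<open>q = x\<^sub>1 - x\<^sub>2\<close>
    (\<open>double_split_pair\<close>), so the two operators send \<open>(p, q)\<close> to \<open>(p, 0)\<close> and to \<open>(0, q)\<close>;
  \<^item> the bracket of the double corresponds to \<open>([p, p'], [q, q']\<^sub>B)\<close> (\<open>double_bracket_split\<close>);
  \<^item> the form of the double corresponds to \<open>S(p, p') - S(q, B (T q'))\<close> (\<open>double_form_split\<close>).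

  The second formula reduces the Lie algebra axioms of the double to those of the two brackets.
  The third reduces nondegeneracy and invariance to those of \<open>S\<close>, since \<open>T\<close> is adjoint to \<open>B\<close>.
\<close>

section \<open>Calculating on carriers\<close>

context lie_algebra
begin

lemma carrier_zero: "0 \<in> L"
  and carrier_add: "\<lbrakk>x \<in> L; y \<in> L\<rbrakk> \<Longrightarrow> x + y \<in> L"
  and carrier_scale: "x \<in> L \<Longrightarrow> scale a x \<in> L"
  using subspace_carrier by (simp_all add: subspace_0 subspace_add subspace_scale)

lemmas carrier_intros =
  carrier_zero carrier_add carrier_scale carrier_diff bracket_closed

lemma bracket_add_right:
  "\<lbrakk>x \<in> L; y \<in> L; z \<in> L\<rbrakk> \<Longrightarrow> br x (y + z) = br x y + br x z"
  and bracket_add_left: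
  "\<lbrakk>x \<in> L; y \<in> L; z \<in> L\<rbrakk> \<Longrightarrow> br (x + y) z = br x z + br y z"
  and bracket_scale_right: "\<lbrakk>x \<in> L; y \<in> L\<rbrakk> \<Longrightarrow> br x (scale a y) = scale a (br x y)"
  and bracket_scale_left: "\<lbrakk>x \<in> L; y \<in> L\<rbrakk> \<Longrightarrow> br (scale a x) y = scale a (br x y)"
  using bracket_bilinear unfolding bilinear_map_on_def linear_map_on_def by blast+

lemma bracket_diff_left:
  "\<lbrakk>x \<in> L; y \<in> L; z \<in> L\<rbrakk> \<Longrightarrow> br (x - y) z = br x z - br y z"
  using bracket_add_left[of "x - y" y z] by (simp add: carrier_diff algebra_simps)

lemma bracket_zero_right: "x \<in> L \<Longrightarrow> br x 0 = 0"
  and bracket_zero_left: "x \<in> L \<Longrightarrow> br 0 x = 0"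
  using bracket_diff_right[of x 0 0] bracket_diff_left[of 0 0 x] by (simp_all add: carrier_zero)

text \<open>Polarization of \<open>[x + y, x + y] = 0\<close>.\<close>

lemma bracket_swap: "\<lbrakk>x \<in> L; y \<in> L\<rbrakk> \<Longrightarrow> br y x = - br x y"
  using bracket_alternating[of "x + y"] bracket_alternating[of x] bracket_alternating[of y]
  by (simp add: carrier_add bracket_add_left bracket_add_right add_eq_0_iff)

lemmas bracket_linear =
  bracket_add_left bracket_add_right bracket_diff_left bracket_diff_right
  bracket_scale_left bracket_scale_right bracket_zero_left bracket_zero_right

end

context quadratic_lie_algebra
begin

lemma form_add_right: "\<lbrakk>x \<in> L; y \<in> L; z \<in> L\<rbrakk> \<Longrightarrow> S x (y + z) = S x y + S x z"
  and form_add_left: "\<lbrakk>x \<in> L; y \<in> L; z \<in> L\<rbrakk> \<Longrightarrow> S (x + y) z = S x z + S y z"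
  and form_scale_right: "\<lbrakk>x \<in> L; y \<in> L\<rbrakk> \<Longrightarrow> S x (scale a y) = a * S x y"
  and form_scale_left: "\<lbrakk>x \<in> L; y \<in> L\<rbrakk> \<Longrightarrow> S (scale a x) y = a * S x y"
  using form_bilinear unfolding bilinear_map_on_def linear_map_on_def by blast+

lemma form_diff_right: "\<lbrakk>x \<in> L; y \<in> L; z \<in> L\<rbrakk> \<Longrightarrow> S x (y - z) = S x y - S x z"
  and form_diff_left: "\<lbrakk>x \<in> L; y \<in> L; z \<in> L\<rbrakk> \<Longrightarrow> S (x - y) z = S x z - S y z"
  using form_add_right[of x "y - z" z] form_add_left[of "x - y" y z]
  by (simp_all add: carrier_diff algebra_simps)

lemma form_zero_right: "x \<in> L \<Longrightarrow> S x 0 = 0"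
  and form_zero_left: "x \<in> L \<Longrightarrow> S 0 x = 0"
  using form_diff_right[of x 0 0] form_diff_left[of 0 0 x] by (simp_all add: carrier_zero)

lemmas form_linear =
  form_add_left form_add_right form_diff_left form_diff_right
  form_scale_left form_scale_right form_zero_left form_zero_right

end


section \<open>The descendent Lie bracket\<close>

locale rota_baxter_minus_one = rota_baxter_lie_algebra scale L br B "- 1"
  for scale :: "'k::field \<Rightarrow> 'v::ab_group_add \<Rightarrow> 'v"
    and L :: "'v set"
    and br :: "'v \<Rightarrow> 'v \<Rightarrow> 'v"
    and B :: "'v \<Rightarrow> 'v"
begin

abbreviation T :: "'v \<Rightarrow> 'v"
  where "T \<equiv> rb_tilde B"

definition descendent_bracket :: "'v \<Rightarrow> 'v \<Rightarrow> 'v"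
  where "descendent_bracket x y = br (B x) y + br x (B y) - br x y"

lemma operator_add: "\<lbrakk>x \<in> L; y \<in> L\<rbrakk> \<Longrightarrow> B (x + y) = B x + B y"
  and operator_scale: "x \<in> L \<Longrightarrow> B (scale a x) = scale a (B x)"
  using operator_linear unfolding linear_map_on_def by blast+

lemma operator_zero: "B 0 = 0"
  using operator_diff[of 0 0] by (simp add: carrier_zero)

lemma tilde_add: "\<lbrakk>x \<in> L; y \<in> L\<rbrakk> \<Longrightarrow> T (x + y) = T x + T y"
  and tilde_scale: "x \<in> L \<Longrightarrow> T (scale a x) = scale a (T x)"
  and tilde_zero: "T 0 = 0"
  by (simp_all add: rb_tilde_def operator_add operator_scale operator_zero
      scale_right_diff_distrib)

lemmas operators_linear =
  operator_add operator_diff operator_scale operator_zero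
  tilde_add tilde_diff tilde_scale tilde_zero

lemma operator_tilde_commute: "x \<in> L \<Longrightarrow> B (T x) = T (B x)"
  by (simp add: rb_tilde_def operator_diff operator_closed)

lemma descendent_closed: "\<lbrakk>x \<in> L; y \<in> L\<rbrakk> \<Longrightarrow> descendent_bracket x y \<in> L"
  by (simp add: descendent_bracket_def carrier_intros operator_closed)

lemmas closed = carrier_intros operator_closed tilde_closed descendent_closed

text \<open>
  The Rota-Baxter identity of weight \<open>-1\<close> says that \<open>B\<close> turns the descendent bracket into the
  original one. Since \<open>T\<close> is a Rota-Baxter operator of the same weight whose descendent bracket
  is the negative of that of \<open>B\<close>, the same holds for \<open>T\<close> up to sign.
\<close>

lemma operator_descendent:
  "\<lbrakk>x \<in> L; y \<in> L\<rbrakk> \<Longrightarrow> B (descendent_bracket x y) = br (B x) (B y)"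
  using rota_baxter[of x y] by (simp add: descendent_bracket_def scale_minus_left)

lemma tilde_descendent:
  "\<lbrakk>x \<in> L; y \<in> L\<rbrakk> \<Longrightarrow> T (descendent_bracket x y) = - br (T x) (T y)"
proof -
  assume L: "x \<in> L" "y \<in> L"
  have "T (descendent_bracket x y) = descendent_bracket x y - br (B x) (B y)"
    by (simp add: rb_tilde_def operator_descendent L)
  also have "\<dots> = - br (T x) (T y)"
    using L by (simp add: descendent_bracket_def rb_tilde_def closed bracket_linear algebra_simps)
  finally show ?thesis .
qed

lemma descendent_alternating: "x \<in> L \<Longrightarrow> descendent_bracket x x = 0"
  using bracket_swap[of x "B x"]
  by (simp add: descendent_bracket_def closed bracket_alternating)

lemma descendent_add_right: "\<lbrakk>x \<in> L; y \<in> L; z \<in> L\<rbrakk> \<Longrightarrow>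
    descendent_bracket x (y + z) = descendent_bracket x y + descendent_bracket x z"
  and descendent_add_left: "\<lbrakk>x \<in> L; y \<in> L; z \<in> L\<rbrakk> \<Longrightarrow>
    descendent_bracket (x + y) z = descendent_bracket x z + descendent_bracket y z"
  and descendent_scale_right: "\<lbrakk>x \<in> L; y \<in> L\<rbrakk> \<Longrightarrow>
    descendent_bracket x (scale a y) = scale a (descendent_bracket x y)"
  and descendent_scale_left: "\<lbrakk>x \<in> L; y \<in> L\<rbrakk> \<Longrightarrow>
    descendent_bracket (scale a x) y = scale a (descendent_bracket x y)"
  by (simp_all add: descendent_bracket_def operators_linear bracket_linear closed
      scale_right_distrib scale_right_diff_distrib)

lemmas descendent_linear =
  descendent_add_left descendent_add_right descendent_scale_left descendent_scale_right

lemma descendent_zero: "x \<in> L \<Longrightarrow> descendent_bracket x 0 = 0"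
  "x \<in> L \<Longrightarrow> descendent_bracket 0 x = 0"
  by (simp_all add: descendent_bracket_def operator_zero bracket_linear closed)

text \<open>
  The inner bracket is only expanded where \<open>B\<close> is not applied to it; under \<open>B\<close> it collapses to
  \<open>[B y, B z]\<close>. The seven terms are \<open>[x, [y, z]]\<close> with \<open>B\<close> put on at most two of the three
  letters, with sign \<open>(-1)\<close> to the number of the letters without \<open>B\<close>, minus one.
\<close>

lemma descendent_expand:
  assumes "x \<in> L" "y \<in> L" "z \<in> L"
  shows "descendent_bracket x (descendent_bracket y z)
    = br (B x) (br (B y) z) + br (B x) (br y (B z)) + br x (br (B y) (B z))
      - br (B x) (br y z) - br x (br (B y) z) - br x (br y (B z)) + br x (br y z)"
proof -
  have "descendent_bracket x (descendent_bracket y z)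
    = br (B x) (descendent_bracket y z) + br x (br (B y) (B z)) - br x (descendent_bracket y z)"
    using assms by (simp add: descendent_bracket_def[of x] operator_descendent)
  then show ?thesis
    using assms by (simp add: descendent_bracket_def bracket_linear closed algebra_simps)
qed

lemma descendent_jacobi:
  assumes L: "x \<in> L" "y \<in> L" "z \<in> L"
  shows "descendent_bracket x (descendent_bracket y z)
    + descendent_bracket y (descendent_bracket z x)
    + descendent_bracket z (descendent_bracket x y) = 0"
proof -
  \<comment> \<open>The cyclic sum of the expansion is a signed sum of seven Jacobi identities of \<open>br\<close>, one for
    each placement of \<open>B\<close>.\<close>
  define J where "J a b c = br a (br b c) + br b (br c a) + br c (br a b)" for a b c
  have J: "J a b c = 0" if "a \<in> L" "b \<in> L" "c \<in> L" for a b c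
    unfolding J_def using that by (rule jacobi)
  have "descendent_bracket x (descendent_bracket y z)
      + descendent_bracket y (descendent_bracket z x)
      + descendent_bracket z (descendent_bracket x y)
    = J (B x) (B y) z + J (B x) y (B z) + J x (B y) (B z)
      - J (B x) y z - J x (B y) z - J x y (B z) + J x y z"
    unfolding J_def by (simp add: descendent_expand L algebra_simps)
  then show ?thesis by (simp add: J closed L)
qed


section \<open>Splitting the double into two commuting ideals\<close>

text \<open>
  This is the sum of \<open>(B p, T p)\<close> and \<open>(B (T q), - T (B q))\<close>, written as a pair \<open>(B x\<^sub>1, T x\<^sub>2)\<close>
  so that the descriptions on representatives apply to it.
\<close>

definition double_split :: "'v \<Rightarrow> 'v \<Rightarrow> 'v \<times> 'v"
  where "double_split p q = (B (p + T q), T (p - B q))"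

lemma double_split_pair:
  assumes "x1 \<in> L" "x2 \<in> L"
  shows "(B x1, T x2) = double_split (B x1 + T x2) (x1 - x2)"
proof -
  have "B x1 + T x2 + T (x1 - x2) = x1" "B x1 + T x2 - B (x1 - x2) = x2"
    using assms by (simp_all add: rb_tilde_def closed operators_linear)
  then show ?thesis by (simp add: double_split_def)
qed

lemma split_coordinates:
  assumes "p \<in> L" "q \<in> L"
  shows "B (p + T q) + T (p - B q) = p" "(p + T q) - (p - B q) = q"
  using assms by (simp_all add: rb_tilde_def operators_linear closed)

lemma double_split_mem: "\<lbrakk>p \<in> L; q \<in> L\<rbrakk> \<Longrightarrow> double_split p q \<in> rb_double L B"
  by (simp add: double_split_def rb_double_def closed)

lemma double_split_cases:
  assumes "z \<in> rb_double L B"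
  obtains p q where "p \<in> L" "q \<in> L" "z = double_split p q"
proof -
  obtain x1 x2 where x: "x1 \<in> L" "x2 \<in> L" "z = (B x1, T x2)"
    using assms by (auto simp: rb_double_def)
  show thesis
  proof (rule that)
    show "B x1 + T x2 \<in> L" "x1 - x2 \<in> L"
      using x(1,2) by (simp_all add: closed)
    show "z = double_split (B x1 + T x2) (x1 - x2)"
      using x by (simp only: double_split_pair)
  qed
qed

lemma double_split_add: "\<lbrakk>p \<in> L; q \<in> L; p' \<in> L; q' \<in> L\<rbrakk> \<Longrightarrow>
    double_split p q + double_split p' q' = double_split (p + p') (q + q')"
  by (simp add: double_split_def operators_linear closed)

lemma double_split_diff: "\<lbrakk>p \<in> L; q \<in> L; p' \<in> L; q' \<in> L\<rbrakk> \<Longrightarrow>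
    double_split p q - double_split p' q' = double_split (p - p') (q - q')"
  by (simp add: double_split_def operators_linear closed)

lemma double_split_zero: "double_split 0 0 = 0"
  by (simp add: double_split_def operators_linear zero_prod_def)

lemma prod_scale: "module_prod.scale scale scale a (x, y) = (scale a x, scale a y)"
  by (simp add: module_prod.scale_prod module_prod_def module_pair_def module_axioms)

lemma double_split_scale: "\<lbrakk>p \<in> L; q \<in> L\<rbrakk> \<Longrightarrow>
    module_prod.scale scale scale a (double_split p q) = double_split (scale a p) (scale a q)"
  by (simp add: double_split_def prod_scale operators_linear closed scale_right_distrib
      scale_right_diff_distrib)

text \<open>
  The Rota-Baxter identities for \<open>B\<close> and \<open>T\<close> put each component of the bracket under a single
  \<open>B\<close> or \<open>T\<close>, and then the elements \<open>x\<^sub>i\<close>, \<open>y\<^sub>i\<close> enter, apart from themselves, only through the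
  sums \<open>B x\<^sub>1 + T x\<^sub>2\<close> and \<open>B y\<^sub>1 + T y\<^sub>2\<close>. This is where the addition map appears.
\<close>

lemma double_bracket_pair:
  assumes L: "x1 \<in> L" "x2 \<in> L" "y1 \<in> L" "y2 \<in> L"
  shows "rb_double_bracket L br B (B x1, T x2) (B y1, T y2)
    = (B (br (B x1 + T x2) y1 + br x1 (B y1 + T y2) - br x1 y1),
       T (br (B x1 + T x2) y2 + br x2 (B y1 + T y2) - br x2 y2))"
proof -
  have 1: "br (B x1) (B y1) = B (br (B x1) y1 + br x1 (B y1) - br x1 y1)"
    using L operator_descendent[of x1 y1] by (simp add: descendent_bracket_def)
  have "descendent_bracket x2 y2 = - (br (T x2) y2 + br x2 (T y2) - br x2 y2)"
    using L by (simp add: descendent_bracket_def rb_tilde_def bracket_linear closed)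
  then have 2: "br (T x2) (T y2) = T (br (T x2) y2 + br x2 (T y2) - br x2 y2)"
    using L tilde_descendent[of x2 y2] tilde_diff[of 0 "br (T x2) y2 + br x2 (T y2) - br x2 y2"]
    by (simp add: closed tilde_zero)
  have s: "br (T y2) x1 = - br x1 (T y2)" "br (B y1) x2 = - br x2 (B y1)"
    using L by (auto intro!: bracket_swap simp: closed)
  have n: "B (- v) = - B v" "T (- v) = - T v" if "v \<in> L" for v
    using that operator_diff[of 0 v] tilde_diff[of 0 v]
    by (simp_all add: closed operators_linear)
  show ?thesis
    using L by (simp add: rb_act_plus_eq rb_act_minus_eq 1 2 s n operators_linear bracket_linear
        closed algebra_simps)
qed

text \<open>
  In the coordinates \<open>x\<^sub>1 = p + T q\<close>, \<open>x\<^sub>2 = p - B q\<close> the sum \<open>B x\<^sub>1 + T x\<^sub>2\<close> is \<open>p\<close>, and all mixed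
  terms of \<open>[p, y\<^sub>i] + [x\<^sub>i, p'] - [x\<^sub>i, y\<^sub>i]\<close> cancel.
\<close>

lemma double_bracket_split:
  assumes L: "p \<in> L" "q \<in> L" "p' \<in> L" "q' \<in> L"
  shows "rb_double_bracket L br B (double_split p q) (double_split p' q')
    = double_split (br p p') (descendent_bracket q q')"
proof -
  have 1: "br p (p' + T q') + br (p + T q) p' - br (p + T q) (p' + T q')
      = br p p' - br (T q) (T q')"
    using L by (simp add: bracket_linear closed)
  have 2: "br p (p' - B q') + br (p - B q) p' - br (p - B q) (p' - B q')
      = br p p' - br (B q) (B q')"
    using L by (simp add: bracket_linear closed)
  show ?thesis
    using L unfolding double_split_def
    by (simp add: double_bracket_pair closed split_coordinates(1) 1 2 operator_descendent
        tilde_descendent del: rb_double_bracket.simps)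
qed

lemma prod_vector_space: "vector_space (module_prod.scale scale scale)"
proof -
  interpret vector_space_prod scale scale by unfold_locales
  show ?thesis by (rule p.vector_space_axioms)
qed

lemma subspace_prod:
  assumes "subspace M" "subspace N"
  shows "module.subspace (module_prod.scale scale scale) (M \<times> N)"
proof -
  interpret vector_space_prod scale scale by unfold_locales
  show ?thesis using assms by (rule subspace_Times)
qed

lemma image_subspaces: "subspace (B ` L)" "subspace (T ` L)"
proof -
  have "subspace (f ` L)"
    if f: "\<And>x y. \<lbrakk>x \<in> L; y \<in> L\<rbrakk> \<Longrightarrow> f (x + y) = f x + f y"
      "\<And>a x. x \<in> L \<Longrightarrow> f (scale a x) = scale a (f x)" "f 0 = 0" for f
    unfolding subspace_def
  proof (intro conjI ballI allI)
    show "0 \<in> f ` L" using f(3) carrier_zero by (metis image_eqI)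
    show "x + y \<in> f ` L" if "x \<in> f ` L" "y \<in> f ` L" for x y
      using that by (auto simp: carrier_add simp flip: f(1))
    show "scale a x \<in> f ` L" if "x \<in> f ` L" for a x
      using that by (auto simp: carrier_scale simp flip: f(2))
  qed
  then show "subspace (B ` L)" "subspace (T ` L)"
    by (simp_all add: operators_linear)
qed

lemma double_lie_algebra:
  "lie_algebra (module_prod.scale scale scale) (rb_double L B) (rb_double_bracket L br B)"
proof -
  interpret P: vector_space "module_prod.scale scale scale" by (rule prod_vector_space)
  note [simp] = closed double_split_add double_split_scale double_bracket_split double_split_mem
    bracket_linear descendent_linear
  show ?thesis
  proof
    show "P.subspace (rb_double L B)"
      unfolding rb_double_def using image_subspaces by (rule subspace_prod)
    show "bilinear_map_on (module_prod.scale scale scale) (module_prod.scale scale scale)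
      (rb_double L B) (rb_double_bracket L br B)"
      unfolding bilinear_map_on_def linear_map_on_def
      by (auto elim!: double_split_cases)
  next
    fix x y assume "x \<in> rb_double L B" "y \<in> rb_double L B"
    then show "rb_double_bracket L br B x y \<in> rb_double L B"
      by (auto elim!: double_split_cases)
  next
    fix x assume "x \<in> rb_double L B"
    then show "rb_double_bracket L br B x x = 0"
      by (auto elim!: double_split_cases
          simp: bracket_alternating descendent_alternating double_split_zero)
  next
    fix x y z
    assume D: "x \<in> rb_double L B" "y \<in> rb_double L B" "z \<in> rb_double L B"
    obtain p q where x: "p \<in> L" "q \<in> L" "x = double_split p q"
      using D(1) by (rule double_split_cases)
    obtain p' q' where y: "p' \<in> L" "q' \<in> L" "y = double_split p' q'"
      using D(2) by (rule double_split_cases)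
    obtain p'' q'' where z: "p'' \<in> L" "q'' \<in> L" "z = double_split p'' q''"
      using D(3) by (rule double_split_cases)
    note L = x(1,2) y(1,2) z(1,2) and xyz = x(3) y(3) z(3)
    have "rb_double_bracket L br B x (rb_double_bracket L br B y z)
      + rb_double_bracket L br B y (rb_double_bracket L br B z x)
      + rb_double_bracket L br B z (rb_double_bracket L br B x y)
      = double_split (br p (br p' p'') + br p' (br p'' p) + br p'' (br p p'))
          (descendent_bracket q (descendent_bracket q' q'')
            + descendent_bracket q' (descendent_bracket q'' q)
            + descendent_bracket q'' (descendent_bracket q q'))"
      using L by (simp add: xyz del: bracket_linear)
    also have "\<dots> = 0"
      using L by (simp only: jacobi descendent_jacobi double_split_zero)
    finally show "rb_double_bracket L br B x (rb_double_bracket L br B y z)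
      + rb_double_bracket L br B y (rb_double_bracket L br B z x)
      + rb_double_bracket L br B z (rb_double_bracket L br B x y) = 0" .
  qed
qed

text \<open>
  Both prescriptions depend on \<open>x\<^sub>1\<close> and \<open>x\<^sub>2\<close> only through \<open>B x\<^sub>1\<close> and \<open>T x\<^sub>2\<close>; for the second
  one this uses that \<open>B\<close> and \<open>T\<close> commute.
\<close>

lemma rb_proj_pair:
  assumes L: "x1 \<in> L" "x2 \<in> L"
  shows "rb_proj L B (B x1, T x2) = (B (B x1 + T x2), T (B x1 + T x2))"
  unfolding rb_proj_def
proof (rule the_equality)
  show "\<exists>x1'\<in>L. \<exists>x2'\<in>L. (B x1, T x2) = (B x1', T x2') \<and>
      (B (B x1 + T x2), T (B x1 + T x2)) = (B (B x1' + T x2'), T (B x1' + T x2'))"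
    by (rule bexI[OF _ L(1)], rule bexI[OF _ L(2)]) (rule conjI[OF refl refl])
next
  fix w assume "\<exists>x1'\<in>L. \<exists>x2'\<in>L. (B x1, T x2) = (B x1', T x2') \<and>
      w = (B (B x1' + T x2'), T (B x1' + T x2'))"
  then obtain x1' x2' where "(B x1, T x2) = (B x1', T x2')"
    and w: "w = (B (B x1' + T x2'), T (B x1' + T x2'))" by (elim bexE conjE) (rule that)
  then have e: "B x1' = B x1" "T x2' = T x2" by simp_all
  show "w = (B (B x1 + T x2), T (B x1 + T x2))"
    unfolding w e ..
qed

lemma rb_proj_tilde_pair:
  assumes L: "x1 \<in> L" "x2 \<in> L"
  shows "rb_proj_tilde L B (B x1, T x2) = (B (T (x1 - x2)), - T (B (x1 - x2)))"
  unfolding rb_proj_tilde_def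
proof (rule the_equality)
  show "\<exists>x1'\<in>L. \<exists>x2'\<in>L. (B x1, T x2) = (B x1', T x2') \<and>
      (B (T (x1 - x2)), - T (B (x1 - x2))) = (B (T (x1' - x2')), - T (B (x1' - x2')))"
    by (rule bexI[OF _ L(1)], rule bexI[OF _ L(2)]) (rule conjI[OF refl refl])
next
  have *: "(B (T (a - b)), - T (B (a - b))) = (T (B a) - B (T b), B (T b) - T (B a))"
    if "a \<in> L" "b \<in> L" for a b
    using that by (simp add: operator_tilde_commute operators_linear closed)
  fix w assume "\<exists>x1'\<in>L. \<exists>x2'\<in>L. (B x1, T x2) = (B x1', T x2') \<and>
      w = (B (T (x1' - x2')), - T (B (x1' - x2')))"
  then obtain x1' x2' where "x1' \<in> L" "x2' \<in> L" "B x1' = B x1" "T x2' = T x2"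
    "w = (B (T (x1' - x2')), - T (B (x1' - x2')))"
    by (elim bexE conjE Pair_inject) (rule that; simp)
  then show "w = (B (T (x1 - x2)), - T (B (x1 - x2)))"
    using L by (simp only: *)
qed

lemma rb_proj_split: "\<lbrakk>p \<in> L; q \<in> L\<rbrakk> \<Longrightarrow> rb_proj L B (double_split p q) = double_split p 0"
  using split_coordinates(1)[of p q]
  by (simp add: double_split_def rb_proj_pair closed operator_zero tilde_zero)

lemma rb_proj_tilde_split:
  assumes "p \<in> L" "q \<in> L"
  shows "rb_proj_tilde L B (double_split p q) = double_split 0 q"
proof -
  have "rb_proj_tilde L B (double_split p q) = (B (T q), - T (B q))"
    using assms split_coordinates(2)[of p q]
    by (simp only: double_split_def rb_proj_tilde_pair closed)
  also have "\<dots> = double_split 0 q"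
    using assms tilde_diff[of 0 "B q"] by (simp add: double_split_def closed tilde_zero)
  finally show ?thesis .
qed

end


section \<open>The form and the Manin triple\<close>

locale quadratic_rota_baxter_minus_one =
  quadratic_rota_baxter_lie_algebra scale L br B S "- 1"
  for scale :: "'k::field \<Rightarrow> 'v::ab_group_add \<Rightarrow> 'v"
    and L :: "'v set"
    and br :: "'v \<Rightarrow> 'v \<Rightarrow> 'v"
    and B :: "'v \<Rightarrow> 'v"
    and S :: "'v \<Rightarrow> 'v \<Rightarrow> 'k"
begin

sublocale rota_baxter_minus_one scale L br B
  by unfold_locales

text \<open>Compatibility of \<open>S\<close> with \<open>B\<close> in weight \<open>-1\<close> means that \<open>B\<close> and \<open>T\<close> are adjoint.\<close>

lemma form_adjoint: "\<lbrakk>x \<in> L; y \<in> L\<rbrakk> \<Longrightarrow> S (B x) y = S x (T y)"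
  and form_adjoint_tilde: "\<lbrakk>x \<in> L; y \<in> L\<rbrakk> \<Longrightarrow> S (T x) y = S x (B y)"
  using form_compatible[of x y]
  by (simp_all add: rb_tilde_def form_linear closed algebra_simps)

text \<open>
  Moving every operator to the right argument, the mixed terms cancel by \<open>B T = T B\<close>, and the
  remaining ones combine by \<open>B + T = id\<close>: the coefficient of \<open>S(q, - )\<close> is
  \<open>- (B T B + T B T) = - B T\<close>.
\<close>

lemma double_form_split:
  assumes L: "p \<in> L" "q \<in> L" "p' \<in> L" "q' \<in> L"
  shows "rb_double_form L B S (double_split p q) (double_split p' q')
    = S p p' - S q (B (T q'))"
proof -
  have "rb_double_form L B S (double_split p q) (double_split p' q')
    = S (B (p + T q)) (p' - B q') + S (B (p' + T q')) (p - B q)"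
    using L by (simp add: double_split_def rb_double_form_eq closed)
  also have "\<dots> = S (p + T q) (T (p' - B q')) + S (p - B q) (B (p' + T q'))"
    using L by (simp add: form_adjoint closed form_symmetric[of _ "p - B q"])
  also have "\<dots> = S p p' - S q (B (T q'))"
  proof -
    have e: "S (T q) (T v) = S q (B (T v))" "S (B q) (B v) = S q (T (B v))"
       "S (T q) v = S q (B v)" "S (B q) v = S q (T v)" if "v \<in> L" for v
      using that L by (simp_all add: form_adjoint form_adjoint_tilde closed)
    have "S p (T p') + S p (B p') = S p p'"
      "S q (T (B (B q'))) + S q (T (B (T q'))) = S q (T (B q'))"
      using L by (simp_all add: closed operators_linear form_linear rb_tilde_def)
    then show ?thesis
      using L by (simp add: e form_linear operators_linear closed operator_tilde_commute
         algebra_simps)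
  qed
  finally show ?thesis .
qed

text \<open>
  The form \<open>S(q, B (T q'))\<close> may be degenerate, but its radical is the kernel of \<open>B \<circ> T\<close>, which
  consists of the \<open>q\<close> with \<open>double_split 0 q = 0\<close>. Its invariance under the descendent bracket follows
  by writing it as \<open>S(B q, B q')\<close>: as \<open>B\<close> is a homomorphism from the descendent bracket, this is
  the pullback of the invariant form \<open>S\<close>.
\<close>

lemma double_quadratic:
  "quadratic_lie_algebra (module_prod.scale scale scale) (rb_double L B)
     (rb_double_bracket L br B) (rb_double_form L B S)"
proof -
  interpret D: lie_algebra "module_prod.scale scale scale" "rb_double L B"
    "rb_double_bracket L br B" by (rule double_lie_algebra)
  note [simp] = closed double_split_add double_split_scale double_bracket_split double_split_mem
    double_form_split form_linear operators_linear
  have swap: "S q' (B (T q)) = S q (B (T q'))" if "q \<in> L" "q' \<in> L" for q q'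
    using that by (simp add: form_symmetric[of q'] form_adjoint form_adjoint_tilde
        operator_tilde_commute)
  show ?thesis
  proof
    show "bilinear_map_on (module_prod.scale scale scale) (*) (rb_double L B)
        (rb_double_form L B S)"
      unfolding bilinear_map_on_def linear_map_on_def
      by (auto elim!: double_split_cases simp: algebra_simps)
  next
    fix x y assume D: "x \<in> rb_double L B" "y \<in> rb_double L B"
    obtain p q where x: "p \<in> L" "q \<in> L" "x = double_split p q"
      using D(1) by (rule double_split_cases)
    obtain p' q' where y: "p' \<in> L" "q' \<in> L" "y = double_split p' q'"
      using D(2) by (rule double_split_cases)
    note L = x(1,2) y(1,2) and xy = x(3) y(3)
    show "rb_double_form L B S x y = rb_double_form L B S y x"
      using L by (simp add: xy form_symmetric[OF L(1,3)] swap[OF L(2,4)])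
  next
    fix z assume z: "z \<in> rb_double L B"
      and orth: "\<And>w. w \<in> rb_double L B \<Longrightarrow> rb_double_form L B S z w = 0"
    obtain p q where pq: "p \<in> L" "q \<in> L" "z = double_split p q"
      using z by (rule double_split_cases)
    have o: "S p p' - S q (B (T q')) = 0" if "p' \<in> L" "q' \<in> L" for p' q'
      using orth[of "double_split p' q'"] that pq by simp
    have "p = 0"
      using o[of _ 0] pq by (intro form_nondegenerate) auto
    moreover have "B (T q) = 0"
    proof (rule form_nondegenerate)
      fix y assume "y \<in> L"
      then show "S (B (T q)) y = 0"
        using o[of 0 y] pq swap[of q y] form_symmetric[of "B (T q)" y] by simp
    qed (use pq in simp)
    ultimately show "z = 0"
      using pq operator_tilde_commute[of q] tilde_diff[of 0 "B q"]
      by (simp add: double_split_def zero_prod_def)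
  next
    fix x y z
    assume D: "x \<in> rb_double L B" "y \<in> rb_double L B" "z \<in> rb_double L B"
    obtain p q where x: "p \<in> L" "q \<in> L" "x = double_split p q"
      using D(1) by (rule double_split_cases)
    obtain p' q' where y: "p' \<in> L" "q' \<in> L" "y = double_split p' q'"
      using D(2) by (rule double_split_cases)
    obtain p'' q'' where z: "p'' \<in> L" "q'' \<in> L" "z = double_split p'' q''"
      using D(3) by (rule double_split_cases)
    note L = x(1,2) y(1,2) z(1,2) and xyz = x(3) y(3) z(3)
    have "S (descendent_bracket q q') (B (T q'')) = S (br (B q) (B q')) (B q'')"
      using L by (simp add: operator_tilde_commute operator_descendent flip: form_adjoint)
    also have "\<dots> = S (B q) (br (B q') (B q''))"
      using L by (simp add: form_invariant)
    also have "\<dots> = S q (B (T (descendent_bracket q' q'')))"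
      using L by (simp add: operator_tilde_commute operator_descendent form_adjoint)
    finally show "rb_double_form L B S (rb_double_bracket L br B x y) z
        = rb_double_form L B S x (rb_double_bracket L br B y z)"
      using L by (simp add: xyz form_invariant)
  qed
qed

lemma double_manin_triple:
  "manin_triple (module_prod.scale scale scale) (rb_double L B) (rb_double_bracket L br B)
     (rb_double_form L B S) (rb_double_plus L B) (rb_double_minus L B)"
proof -
  interpret D: quadratic_lie_algebra "module_prod.scale scale scale" "rb_double L B"
    "rb_double_bracket L br B" "rb_double_form L B S" by (rule double_quadratic)
  \<comment> \<open>The zero component is written as a value of \<open>T\<close> or \<open>B\<close>, so that the formulas for bracket and
    form on representatives apply.\<close>
  have plus: "\<exists>x\<in>L. z = (B x, T 0)" if "z \<in> rb_double_plus L B" for z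
    using that by (auto simp: rb_double_plus_def tilde_zero)
  have minus: "\<exists>x\<in>L. z = (B 0, T x)" if "z \<in> rb_double_minus L B" for z
    using that by (auto simp: rb_double_minus_def operator_zero)
  have z: "0 \<in> B ` L" "0 \<in> T ` L"
    using carrier_zero operator_zero tilde_zero by (metis image_eqI)+
  have bp: "rb_double_bracket L br B (B x, T 0) (B y, T 0) \<in> rb_double_plus L B"
    if "x \<in> L" "y \<in> L" for x y
    using that unfolding double_bracket_pair[OF that(1) carrier_zero that(2) carrier_zero]
    by (simp add: rb_double_plus_def closed operator_zero tilde_zero bracket_linear)
  have bm: "rb_double_bracket L br B (B 0, T x) (B 0, T y) \<in> rb_double_minus L B"
    if "x \<in> L" "y \<in> L" for x y
    using that unfolding double_bracket_pair[OF carrier_zero that(1) carrier_zero that(2)]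
    by (simp add: rb_double_minus_def closed operator_zero tilde_zero bracket_linear)
  have sp: "D.subspace (rb_double_plus L B)" and sm: "D.subspace (rb_double_minus L B)"
    unfolding rb_double_plus_def rb_double_minus_def
    using image_subspaces by (simp_all add: subspace_prod)
  show ?thesis
  proof
    show "D.lie_subalgebra (rb_double_plus L B)"
      unfolding D.lie_subalgebra_def
    proof (intro conjI ballI)
      show "rb_double_plus L B \<subseteq> rb_double L B"
        unfolding rb_double_plus_def rb_double_def using z by (intro Sigma_mono) simp_all
    next
      fix v w assume vw: "v \<in> rb_double_plus L B" "w \<in> rb_double_plus L B"
      show "rb_double_bracket L br B v w \<in> rb_double_plus L B"
        using plus[OF vw(1)] plus[OF vw(2)] bp by (elim bexE) (simp only:)
    qed (rule sp)
    show "D.lie_subalgebra (rb_double_minus L B)"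
      unfolding D.lie_subalgebra_def
    proof (intro conjI ballI)
      show "rb_double_minus L B \<subseteq> rb_double L B"
        unfolding rb_double_minus_def rb_double_def using z by (intro Sigma_mono) simp_all
    next
      fix v w assume vw: "v \<in> rb_double_minus L B" "w \<in> rb_double_minus L B"
      show "rb_double_bracket L br B v w \<in> rb_double_minus L B"
        using minus[OF vw(1)] minus[OF vw(2)] bm by (elim bexE) (simp only:)
    qed (rule sm)
    show "D.isotropic (rb_double_plus L B)"
      unfolding D.isotropic_def
    proof (intro ballI)
      fix v w assume "v \<in> rb_double_plus L B" "w \<in> rb_double_plus L B"
      then obtain x y where "x \<in> L" "y \<in> L" "v = (B x, T 0)" "w = (B y, T 0)"
        using plus by metis
      then show "rb_double_form L B S v w = 0"
        by (simp only: rb_double_form_eq carrier_zero)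
          (simp add: form_zero_right operator_closed)
    qed
    show "D.isotropic (rb_double_minus L B)"
      unfolding D.isotropic_def
    proof (intro ballI)
      fix v w assume "v \<in> rb_double_minus L B" "w \<in> rb_double_minus L B"
      then obtain x y where "x \<in> L" "y \<in> L" "v = (B 0, T x)" "w = (B 0, T y)"
        using minus by metis
      then show "rb_double_form L B S v w = 0"
        by (simp only: rb_double_form_eq carrier_zero)
          (simp add: operator_zero form_zero_left)
    qed
    show "rb_double L B = {x + y | x y. x \<in> rb_double_plus L B \<and> y \<in> rb_double_minus L B}"
    proof (intro equalityI subsetI)
      fix v assume "v \<in> rb_double L B"
      then have "(fst v, 0) \<in> rb_double_plus L B" "(0, snd v) \<in> rb_double_minus L B"
        "v = (fst v, 0) + (0, snd v)"
        by (auto simp: rb_double_def rb_double_plus_def rb_double_minus_def)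
      then show "v \<in> {x + y | x y. x \<in> rb_double_plus L B \<and> y \<in> rb_double_minus L B}"
        by blast
    qed (auto simp: rb_double_def rb_double_plus_def rb_double_minus_def)
    show "rb_double_plus L B \<inter> rb_double_minus L B = {0}"
      using z by (auto simp: rb_double_plus_def rb_double_minus_def zero_prod_def)
  qed
qed

text \<open>
  Componentwise projections of a direct product of Lie algebras are idempotent endomorphisms.
  They are orthogonal projections because the form has no terms mixing \<open>p\<close> with \<open>q'\<close>.
\<close>

lemma double_projection:
    "quadratic_lie_algebra_projection (module_prod.scale scale scale) (rb_double L B)
      (rb_double_bracket L br B) (rb_double_form L B S)
      (rb_double_plus L B) (rb_double_minus L B) (rb_proj L B)"
  and double_projection_tilde:
    "quadratic_lie_algebra_projection (module_prod.scale scale scale) (rb_double L B)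
      (rb_double_bracket L br B) (rb_double_form L B S)
      (rb_double_plus L B) (rb_double_minus L B) (rb_proj_tilde L B)"
proof -
  interpret D: manin_triple "module_prod.scale scale scale" "rb_double L B"
    "rb_double_bracket L br B" "rb_double_form L B S" "rb_double_plus L B" "rb_double_minus L B"
    by (rule double_manin_triple)
  note [simp] = closed double_split_add double_split_diff double_split_scale double_bracket_split
    double_split_mem double_form_split form_linear operators_linear bracket_linear
    descendent_zero rb_proj_split rb_proj_tilde_split
  show "quadratic_lie_algebra_projection (module_prod.scale scale scale) (rb_double L B)
      (rb_double_bracket L br B) (rb_double_form L B S)
      (rb_double_plus L B) (rb_double_minus L B) (rb_proj L B)"
    by unfold_locales
      (auto simp: D.lie_endomorphism_def linear_map_on_def elim!: double_split_cases)
  show "quadratic_lie_algebra_projection (module_prod.scale scale scale) (rb_double L B)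
      (rb_double_bracket L br B) (rb_double_form L B S)
      (rb_double_plus L B) (rb_double_minus L B) (rb_proj_tilde L B)"
    by unfold_locales
      (auto simp: D.lie_endomorphism_def linear_map_on_def elim!: double_split_cases)
qed

lemma rb_proj_sum:
  "z \<in> rb_double L B \<Longrightarrow> rb_proj L B z + rb_proj_tilde L B z = z"
  by (auto elim!: double_split_cases
      simp: rb_proj_split rb_proj_tilde_split double_split_add closed)

end

theorem theorem3p10:
  fixes scale :: "'k::field \<Rightarrow> 'v::ab_group_add \<Rightarrow> 'v"
    and \<gg> :: "'v set"
    and br :: "'v \<Rightarrow> 'v \<Rightarrow> 'v"
    and B :: "'v \<Rightarrow> 'v"
    and S :: "'v \<Rightarrow> 'v \<Rightarrow> 'k"
  assumes "quadratic_rota_baxter_lie_algebra scale \<gg> br B S (- 1)"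
  shows "(\<forall>x1\<in>\<gg>. \<forall>x2\<in>\<gg>. rb_proj \<gg> B (B x1, rb_tilde B x2)
        = (B (B x1 + rb_tilde B x2), rb_tilde B (B x1 + rb_tilde B x2)))
    \<and> (\<forall>x1\<in>\<gg>. \<forall>x2\<in>\<gg>. rb_proj_tilde \<gg> B (B x1, rb_tilde B x2)
        = (B (rb_tilde B (x1 - x2)), - rb_tilde B (B (x1 - x2))))
    \<and> quadratic_lie_algebra_projection (module_prod.scale scale scale)
        (rb_double \<gg> B) (rb_double_bracket \<gg> br B) (rb_double_form \<gg> B S)
        (rb_double_plus \<gg> B) (rb_double_minus \<gg> B) (rb_proj \<gg> B)
    \<and> quadratic_lie_algebra_projection (module_prod.scale scale scale)
        (rb_double \<gg> B) (rb_double_bracket \<gg> br B) (rb_double_form \<gg> B S)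
        (rb_double_plus \<gg> B) (rb_double_minus \<gg> B) (rb_proj_tilde \<gg> B)
    \<and> (\<forall>z\<in>rb_double \<gg> B. rb_proj \<gg> B z + rb_proj_tilde \<gg> B z = z)"
proof -
  interpret quadratic_rota_baxter_minus_one scale \<gg> br B S
    using assms by (simp add: quadratic_rota_baxter_minus_one_def)
  show ?thesis
    by (simp add: rb_proj_pair rb_proj_tilde_pair double_projection double_projection_tilde
        rb_proj_sum)
qed

end
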